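(* Let $\omega$ be a nontrivial cube root of unity, let $\omega_1\in\mathbb{C}\setminus\{0\}$, let $\Lambda=\mathbb{Z}\omega_1+\mathbb{Z}\,\omega\omega_1$ be a hexagonal lattice, let $\wp(z)=\wp(z;\Lambda)$, and let $G$ be the wallpaper group p3 realised as the group generated by the translations $z\mapsto z+\lambda$ ($\lambda\in\Lambda$) and the rotation $z\mapsto\omega z$. Then the $G$-invariant meromorphic functions $f:\mathbb{C}\to\mathbb{CP}^1$ are precisely the functions of the form $f(z)=R(\wp'(z))$ with $R$ a rational function with complex coefficients.
   Context: $f$ is $G$-invariant if $f(g.z)=f(z)$ for all $g\in G$ and $z\in\mathbb{C}$. The Weierstrass function of a lattice $\Lambda$ is $\wp(z;\Lambda)=\frac1{z^2}+\sum_{\lambda\in\Lambda\setminus\{0\}}\left(\frac1{(z-\lambda)^2}-\frac1{\lambda^2}\right)$. *)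

theory Defs
  imports
    "HOL-Complex_Analysis.Complex_Analysis"
    "HOL-Computational_Algebra.Computational_Algebra"
    "HOL-Computational_Algebra.Field_as_Ring"
    "HOL-Algebra.Bij"
    "HOL-Algebra.Generated_Groups"
begin

section \<open>Meromorphic functions into the Riemann sphere\<close>

datatype cp1 = Fin complex | Infty

text \<open>The value \<open>0\<close> at \<open>Infty\<close> is the value that \<^const>\<open>nicely_meromorphic_on\<close> prescribes at poles.\<close>

fun fin_part :: "cp1 \<Rightarrow> complex" where
  "fin_part (Fin w) = w"
| "fin_part Infty = 0"

text \<open>
  The function constantly \<open>Infty\<close> is not meromorphic in this sense, since a pole
  of the finite part is an isolated point of the set of poles.
\<close>

definition cp1_meromorphic :: "(complex \<Rightarrow> cp1) \<Rightarrow> bool" where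
  "cp1_meromorphic f \<longleftrightarrow>
     (\<lambda>z. fin_part (f z)) nicely_meromorphic_on UNIV \<and>
     (\<forall>z. f z = Infty \<longleftrightarrow> is_pole (\<lambda>z. fin_part (f z)) z)"

text \<open>The derivative of a meromorphic function has the same poles as the function.\<close>

definition cp1_deriv :: "(complex \<Rightarrow> cp1) \<Rightarrow> complex \<Rightarrow> cp1" where
  "cp1_deriv f z = (if f z = Infty then Infty else Fin (deriv (\<lambda>z. fin_part (f z)) z))"

text \<open>
  A rational function acts on the whole sphere. As \<^const>\<open>quot_of_fract\<close> yields a coprime
  pair, zeros of the denominator \<open>q\<close> are poles; the value at \<open>Infty\<close> is the limit of
  \<open>p w / q w\<close> as \<open>w\<close> tends to infinity.
\<close>

definition rat_eval :: "complex poly fract \<Rightarrow> cp1 \<Rightarrow> cp1" where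
  "rat_eval R x = (case quot_of_fract R of (p, q) \<Rightarrow>
     (case x of
        Fin w \<Rightarrow> if poly q w = 0 then Infty else Fin (poly p w / poly q w)
      | Infty \<Rightarrow> if degree p > degree q then Infty
                 else Fin (coeff p (degree q) / lead_coeff q)))"


section \<open>Lattices, the Weierstrass function and the group p3\<close>

definition int_lattice :: "complex \<Rightarrow> complex \<Rightarrow> complex set" where
  "int_lattice a b = {of_int m * a + of_int n * b | m n. True}"

definition weierstrass_p :: "complex set \<Rightarrow> complex \<Rightarrow> cp1" where
  "weierstrass_p \<Lambda> z =
     (if z \<in> \<Lambda> then Infty
      else Fin (1 / z\<^sup>2 + (\<Sum>\<^sub>\<infinity>l\<in>\<Lambda> - {0}. 1 / (z - l)\<^sup>2 - 1 / l\<^sup>2)))"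

definition p3_group :: "complex \<Rightarrow> complex set \<Rightarrow> (complex \<Rightarrow> complex) set" where
  "p3_group \<omega> \<Lambda> =
     generate (BijGroup UNIV) ({(\<lambda>z. z + l) | l. l \<in> \<Lambda>} \<union> {\<lambda>z. \<omega> * z})"

definition invariant_under :: "(complex \<Rightarrow> complex) set \<Rightarrow> (complex \<Rightarrow> 'a) \<Rightarrow> bool" where
  "invariant_under G f \<longleftrightarrow> (\<forall>g\<in>G. \<forall>z. f (g z) = f z)"

end

theory Submission
  imports Defs
begin

text \<open>
  Off the lattice, \<open>\<wp>' z = - 2 \<Sum> 1 / (z - l)\<^sup>3\<close>, from which the invariance of \<open>\<wp>'\<close> under
  translations and under \<open>z \<mapsto> \<omega> z\<close> is immediate, as well as the triple poles at the lattice points.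

  Conversely, let \<open>f\<close> be invariant. Modulo \<open>\<Lambda>\<close> it has finitely many poles, so multiplying it by a
  suitable polynomial in \<open>\<wp>'\<close>, a product of powers of \<open>\<wp>' - \<wp>' s\<close>, leaves an invariant function
  \<open>g\<close> whose poles all lie in \<open>\<Lambda>\<close>. Invariance under the rotation makes the order of \<open>g\<close> at 0
  a multiple of 3, hence subtracting a multiple of a power of \<open>\<wp>'\<close> lowers the pole order of \<open>g\<close>
  by at least 3. Iterating, one arrives at a lattice-periodic function without poles, which is constant
  by Liouville's theorem. So \<open>g\<close> is a polynomial in \<open>\<wp>'\<close>, and \<open>f\<close> a quotient of two such
  polynomials.
\<close>

section \<open>Meromorphic functions and polynomials at infinity\<close>

text \<open>The behaviour near \<open>z\<close> fixes the value at \<open>z\<close>: it is 0 at a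
  pole and the limit elsewhere. This turns identities on punctured neighbourhoods into the literal
  equality of functions that the theorem asks for.\<close>

lemma nicely_meromorphic_eqI:
  assumes "f nicely_meromorphic_on UNIV" "g nicely_meromorphic_on UNIV"
    and ev: "eventually (\<lambda>w. f w = g w) (at z)"
  shows "f z = g z"
proof -
  have pole: "is_pole f z \<longleftrightarrow> is_pole g z"
    using ev by (intro is_pole_cong) auto
  show ?thesis
  proof (cases "is_pole f z")
    case True
    hence "\<not> (f \<longlongrightarrow> f z) (at z)" "\<not> (g \<longlongrightarrow> g z) (at z)"
      using pole by (auto simp: is_pole_def dest: not_tendsto_and_filterlim_at_infinity[rotated])
    hence "f z = 0" "g z = 0"
      using assms(1,2) unfolding nicely_meromorphic_on_def by blast+
    thus ?thesis
      by simp
  next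
    case False
    hence "(f \<longlongrightarrow> f z) (at z)" "(g \<longlongrightarrow> g z) (at z)"
      using assms(1,2) pole unfolding nicely_meromorphic_on_def by blast+
    thus ?thesis
      using ev by (metis tendsto_cong tendsto_unique trivial_limit_at)
  qed
qed

text \<open>\<open>fin_part\<close> alone confuses \<open>Fin 0\<close> with \<open>Infty\<close>;
  the pole condition in \<open>cp1_meromorphic\<close> separates them again.\<close>

lemma cp1_meromorphic_eqI:
  assumes f: "cp1_meromorphic f" and g: "cp1_meromorphic g"
    and ev: "\<And>z. eventually (\<lambda>w. fin_part (f w) = fin_part (g w)) (at z)"
  shows "f = g"
proof
  fix z
  have fin: "(\<lambda>w. fin_part (f w)) = (\<lambda>w. fin_part (g w))"
    using f g ev nicely_meromorphic_eqI unfolding cp1_meromorphic_def by blast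
  hence "f z = Infty \<longleftrightarrow> g z = Infty"
    using f g by (simp add: cp1_meromorphic_def)
  moreover have "fin_part (f z) = fin_part (g z)"
    using fin by metis
  ultimately show "f z = g z"
    by (cases "f z"; cases "g z") auto
qed

section \<open>Polynomials and their quotients near infinity\<close>

lemma eventually_poly_nonzero_at_infinity:
  fixes q :: "'a :: real_normed_field poly"
  assumes "q \<noteq> 0"
  shows "eventually (\<lambda>x. poly q x \<noteq> 0) at_infinity"
proof -
  have "finite {x. poly q x = 0}"
    using assms by (rule poly_roots_finite)
  hence "bounded {x. poly q x = 0}"
    by (rule finite_imp_bounded)
  then obtain b where b: "\<And>x. poly q x = 0 \<Longrightarrow> norm x \<le> b"
    by (auto simp: bounded_iff)
  show ?thesis
  proof (rule eventually_at_infinityI)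
    show "poly q x \<noteq> 0" if "b + 1 \<le> norm x" for x
      using that b[of x] by auto
  qed
qed

text \<open>The limit has the form of the value of \<open>rat_eval\<close> at \<open>Infty\<close>.
  For \<open>degree p < degree q\<close> the coefficient in the numerator is 0, so one formula
  serves both cases.\<close>

lemma poly_divide_tendsto_at_infinity:
  fixes p q :: "'a :: real_normed_field poly"
  assumes "degree p \<le> degree q" "q \<noteq> 0"
  shows "((\<lambda>x. poly p x / poly q x) \<longlongrightarrow> coeff p (degree q) / lead_coeff q) at_infinity"
proof (cases "degree p = degree q")
  case True
  have "((\<lambda>x. (poly p x / x ^ degree p) / (poly q x / x ^ degree q)) \<longlongrightarrow> lead_coeff p / lead_coeff q) at_infinity"
    using assms(2) by (intro tendsto_divide poly_divide_tendsto_aux) auto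
  moreover have "eventually (\<lambda>x. (poly p x / x ^ degree p) / (poly q x / x ^ degree q) = poly p x / poly q x) at_infinity"
    using eventually_not_equal_at_infinity[of 0] by eventually_elim (simp add: True)
  ultimately have "((\<lambda>x. poly p x / poly q x) \<longlongrightarrow> lead_coeff p / lead_coeff q) at_infinity"
    by (rule Lim_transform_eventually)
  thus ?thesis
    using True by simp
next
  case False
  thus ?thesis
    using assms poly_divide_tendsto_0_at_infinity[of p q] by (simp add: coeff_eq_0)
qed

lemma poly_divide_filterlim_at_infinity:
  fixes p q :: "'a :: real_normed_field poly"
  assumes "degree q < degree p" "q \<noteq> 0"
  shows "filterlim (\<lambda>x. poly p x / poly q x) at_infinity at_infinity"
proof -
  have "p \<noteq> 0"
    using assms by auto
  have "eventually (\<lambda>x. poly q x / poly p x \<noteq> 0) at_infinity"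
    using eventually_poly_nonzero_at_infinity[OF \<open>p \<noteq> 0\<close>] eventually_poly_nonzero_at_infinity[OF \<open>q \<noteq> 0\<close>]
    by eventually_elim simp
  hence "filterlim (\<lambda>x. poly q x / poly p x) (at 0) at_infinity"
    using poly_divide_tendsto_0_at_infinity[OF assms(1)] by (simp add: filterlim_at)
  hence "filterlim (\<lambda>x. inverse (poly q x / poly p x)) at_infinity at_infinity"
    by (rule filterlim_compose[OF filterlim_inverse_at_infinity])
  thus ?thesis
    by simp
qed

lemma meromorphic_on_poly [meromorphic_intros]:
  "f meromorphic_on A \<Longrightarrow> (\<lambda>z. poly q (f z)) meromorphic_on A"
  by (induction q) (auto intro!: meromorphic_intros)

text \<open>Bounding the pole order by a limit, instead of naming it through \<open>zorder\<close>,
  makes sense for the zero function too and leaves room for enlarging \<open>N\<close>.\<close>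

lemma meromorphic_imp_tendsto_power_mult:
  assumes f: "f meromorphic_on {a}"
  obtains N :: nat and c where "(\<lambda>z. (z - a) ^ N * f z) \<midarrow>a\<rightarrow> c"
proof (cases "eventually (\<lambda>z. f z = 0) (at a)")
  case True
  hence "(\<lambda>z. (z - a) ^ 0 * f z) \<midarrow>a\<rightarrow> 0"
    by (intro tendsto_eventually) (auto elim: eventually_mono)
  thus ?thesis
    by (rule that)
next
  case False
  hence freq: "\<exists>\<^sub>F z in at a. f z \<noteq> 0"
    by (simp add: frequently_def)
  define n h where "n = zorder f a" and "h = zor_poly f a"
  obtain r where r: "r > 0" "h holomorphic_on cball a r"
      and eq: "\<And>w. w \<in> cball a r - {a} \<Longrightarrow> f w = h w * (w - a) powi n"
    using zorder_exist[OF _ _ freq] f unfolding n_def h_def meromorphic_at_iff by blast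
  have "h holomorphic_on ball a r"
    using r(2) by (rule holomorphic_on_subset) auto
  hence "h \<midarrow>a\<rightarrow> h a"
    using r(1) by (meson analytic_at analytic_at_imp_isCont centre_in_ball isContD open_ball)
  hence "(\<lambda>w. h w * (w - a) ^ nat n) \<midarrow>a\<rightarrow> h a * (a - a) ^ nat n"
    by (intro tendsto_intros)
  moreover have "eventually (\<lambda>w. w \<in> cball a r - {a}) (at a)"
    using r(1) eventually_at_in_open[of "ball a r" a] by (auto elim!: eventually_mono)
  \<comment> \<open>At most one of \<open>nat n\<close> and \<open>nat (- n)\<close> is nonzero, so
    zeros (n > 0) and poles (n < 0) are treated by the same formula.\<close>
  hence "eventually (\<lambda>w. h w * (w - a) ^ nat n = (w - a) ^ nat (- n) * f w) (at a)"
  proof eventually_elim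
    case (elim w)
    hence "(w - a) ^ nat (- n) * (w - a) powi n = (w - a) ^ nat n"
      by (cases "n \<ge> 0") (auto simp: power_int_def power_inverse)
    thus ?case
      by (simp add: eq[OF elim] mult_ac)
  qed
  ultimately have "(\<lambda>w. (w - a) ^ nat (- n) * f w) \<midarrow>a\<rightarrow> h a * (a - a) ^ nat n"
    by (rule Lim_transform_eventually)
  thus ?thesis
    by (rule that)
qed


section \<open>Hexagonal lattices\<close>

locale hexagonal_lattice =
  fixes \<omega> \<omega>\<^sub>1 :: complex and \<Lambda> :: "complex set"
  assumes omega_cubed: "\<omega> ^ 3 = 1" and omega_neq_1: "\<omega> \<noteq> 1" and omega1_nonzero: "\<omega>\<^sub>1 \<noteq> 0"
    and Lambda_eq: "\<Lambda> = int_lattice \<omega>\<^sub>1 (\<omega> * \<omega>\<^sub>1)"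
begin

section \<open>The cube root of unity and the norm form of the lattice\<close>

lemma omega_sq: "\<omega>\<^sup>2 = - 1 - \<omega>"
proof -
  have "(\<omega> - 1) * (\<omega>\<^sup>2 + \<omega> + 1) = 0"
    using omega_cubed by (simp add: algebra_simps power2_eq_square power3_eq_cube)
  hence "\<omega>\<^sup>2 + \<omega> + 1 = 0"
    using omega_neq_1 by simp
  thus ?thesis
    by algebra
qed

lemma omega_nonzero: "\<omega> \<noteq> 0"
  using omega_cubed by auto

lemma norm_omega: "norm \<omega> = 1"
proof -
  have "norm \<omega> ^ 3 = 1"
    by (metis norm_one norm_power omega_cubed)
  thus ?thesis
    using power_eq_iff_eq_base[of 3 "norm \<omega>" 1] by simp
qed

text \<open>These are the real and imaginary parts of \<open>omega_sq\<close> combined with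
  |\<omega>| = 1. The sign of the imaginary part stays open because \<omega> may be either primitive
  root.\<close>

lemma Re_omega: "Re \<omega> = - 1 / 2" and Im_omega: "Im \<omega> \<noteq> 0"
proof -
  have re: "(Re \<omega>)\<^sup>2 - (Im \<omega>)\<^sup>2 = - 1 - Re \<omega>" and im: "2 * Re \<omega> * Im \<omega> = - Im \<omega>"
    using omega_sq by (auto simp: complex_eq_iff power2_eq_square mult_ac)
  have abs: "(Re \<omega>)\<^sup>2 + (Im \<omega>)\<^sup>2 = 1"
    using norm_omega by (simp add: cmod_def)
  show "Im \<omega> \<noteq> 0"
  proof
    assume "Im \<omega> = 0"
    hence "(Re \<omega>)\<^sup>2 = - 1 - Re \<omega>" "(Re \<omega>)\<^sup>2 = 1"
      using re abs by auto
    moreover from this have "Re \<omega> = - 2"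
      by simp
    ultimately show False
      by simp
  qed
  moreover have "(2 * Re \<omega> + 1) * Im \<omega> = 0"
    using im by (simp add: algebra_simps)
  ultimately show "Re \<omega> = - 1 / 2"
    by auto
qed

lemma norm_hexagonal:
  "(norm (of_real x * \<omega>\<^sub>1 + of_real y * (\<omega> * \<omega>\<^sub>1)))\<^sup>2 = (x\<^sup>2 - x * y + y\<^sup>2) * (norm \<omega>\<^sub>1)\<^sup>2"
proof -
  have "(Re \<omega>)\<^sup>2 + (Im \<omega>)\<^sup>2 = 1"
    using norm_omega by (simp add: cmod_def)
  hence I: "(Im \<omega>)\<^sup>2 = 3 / 4"
    by (simp add: Re_omega power2_eq_square)
  have "(norm (of_real x + of_real y * \<omega>))\<^sup>2 = x\<^sup>2 - x * y + y\<^sup>2"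
    unfolding cmod_power2 by (simp add: power_mult_distrib I Re_omega) (simp add: power2_eq_square field_simps)
  moreover have "of_real x * \<omega>\<^sub>1 + of_real y * (\<omega> * \<omega>\<^sub>1) = (of_real x + of_real y * \<omega>) * \<omega>\<^sub>1"
    by (simp add: algebra_simps)
  ultimately show ?thesis
    by (simp add: norm_mult power_mult_distrib)
qed

section \<open>Group structure, rotation symmetry and discreteness of the lattice\<close>

lemma lattice_memI: "of_int m * \<omega>\<^sub>1 + of_int n * (\<omega> * \<omega>\<^sub>1) \<in> \<Lambda>"
  by (auto simp: Lambda_eq int_lattice_def)

lemma lattice_memE:
  assumes "l \<in> \<Lambda>"
  obtains m n where "l = of_int m * \<omega>\<^sub>1 + of_int n * (\<omega> * \<omega>\<^sub>1)"
  using assms by (auto simp: Lambda_eq int_lattice_def)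

lemma zero_in_lattice: "0 \<in> \<Lambda>"
  using lattice_memI[of 0 0] by simp

lemma lattice_add:
  assumes "a \<in> \<Lambda>" "b \<in> \<Lambda>" shows "a + b \<in> \<Lambda>"
proof -
  obtain m n k j where "a = of_int m * \<omega>\<^sub>1 + of_int n * (\<omega> * \<omega>\<^sub>1)" "b = of_int k * \<omega>\<^sub>1 + of_int j * (\<omega> * \<omega>\<^sub>1)"
    using assms by (elim lattice_memE)
  hence "a + b = of_int (m + k) * \<omega>\<^sub>1 + of_int (n + j) * (\<omega> * \<omega>\<^sub>1)"
    by (simp add: algebra_simps)
  thus ?thesis
    by (simp only: lattice_memI)
qed

lemma lattice_uminus:
  assumes "a \<in> \<Lambda>" shows "- a \<in> \<Lambda>"
proof -
  obtain m n where "a = of_int m * \<omega>\<^sub>1 + of_int n * (\<omega> * \<omega>\<^sub>1)"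
    using assms by (elim lattice_memE)
  hence "- a = of_int (- m) * \<omega>\<^sub>1 + of_int (- n) * (\<omega> * \<omega>\<^sub>1)"
    by simp
  thus ?thesis
    by (simp only: lattice_memI)
qed

lemma lattice_diff: "a \<in> \<Lambda> \<Longrightarrow> b \<in> \<Lambda> \<Longrightarrow> a - b \<in> \<Lambda>"
  using lattice_add[of a "- b"] lattice_uminus[of b] by simp

lemma lattice_add_iff: "l \<in> \<Lambda> \<Longrightarrow> z + l \<in> \<Lambda> \<longleftrightarrow> z \<in> \<Lambda>"
  using lattice_add[of z l] lattice_diff[of "z + l" l] by auto

text \<open>Because \<omega>^2 = - 1 - \<omega>, the rotation acts on coordinates by the integer
  matrix (m, n) \<mapsto> (- n, m - n).\<close>

lemma lattice_rotate:
  assumes "a \<in> \<Lambda>" shows "\<omega> * a \<in> \<Lambda>"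
proof -
  obtain m n where "a = of_int m * \<omega>\<^sub>1 + of_int n * (\<omega> * \<omega>\<^sub>1)"
    using assms by (elim lattice_memE)
  hence "\<omega> * a = of_int m * (\<omega> * \<omega>\<^sub>1) + of_int n * (\<omega>\<^sup>2 * \<omega>\<^sub>1)"
    by (simp add: algebra_simps power2_eq_square)
  also have "\<dots> = of_int (- n) * \<omega>\<^sub>1 + of_int (m - n) * (\<omega> * \<omega>\<^sub>1)"
    unfolding omega_sq by (simp add: algebra_simps)
  finally show ?thesis
    by (simp only: lattice_memI)
qed

lemma lattice_rotate_iff: "\<omega> * z \<in> \<Lambda> \<longleftrightarrow> z \<in> \<Lambda>"
proof
  assume "\<omega> * z \<in> \<Lambda>"
  hence "\<omega> * (\<omega> * (\<omega> * z)) \<in> \<Lambda>"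
    by (intro lattice_rotate[OF lattice_rotate])
  moreover have "\<omega> * (\<omega> * (\<omega> * z)) = \<omega> ^ 3 * z"
    by (simp add: power3_eq_cube)
  ultimately show "z \<in> \<Lambda>"
    by (simp only: omega_cubed mult_1)
qed (rule lattice_rotate)

text \<open>The norm form m^2 - m n + n^2 is positive definite and takes integer values, so it is at
  least 1 away from the origin.\<close>

lemma norm_lattice_ge:
  assumes "l \<in> \<Lambda>" "l \<noteq> 0" shows "norm \<omega>\<^sub>1 \<le> norm l"
proof -
  obtain m n where l: "l = of_int m * \<omega>\<^sub>1 + of_int n * (\<omega> * \<omega>\<^sub>1)"
    using assms(1) by (elim lattice_memE)
  have "\<not> (m = 0 \<and> n = 0)"
    using l assms(2) by auto
  hence "4 * (m\<^sup>2 - m * n + n\<^sup>2) > 0"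
  proof -
    have "4 * (m\<^sup>2 - m * n + n\<^sup>2) = (2 * m - n)\<^sup>2 + 3 * n\<^sup>2"
      by (simp add: power2_eq_square algebra_simps)
    moreover have "(2 * m - n)\<^sup>2 + 3 * n\<^sup>2 > 0"
      using \<open>\<not> (m = 0 \<and> n = 0)\<close> by (cases "n = 0") (auto intro: add_nonneg_pos)
    ultimately show ?thesis by simp
  qed
  hence "m\<^sup>2 - m * n + n\<^sup>2 \<ge> 1"
    by simp
  hence "real_of_int (m\<^sup>2 - m * n + n\<^sup>2) \<ge> 1"
    by linarith
  hence "(norm \<omega>\<^sub>1)\<^sup>2 * 1 \<le> (norm \<omega>\<^sub>1)\<^sup>2 * real_of_int (m\<^sup>2 - m * n + n\<^sup>2)"
    by (intro mult_left_mono) auto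
  also have "\<dots> = (norm l)\<^sup>2"
    using norm_hexagonal[of "of_int m" "of_int n"] by (simp add: l)
  finally show ?thesis
    by (simp add: power2_le_iff_abs_le)
qed

text \<open>Distinct lattice points are at least |\<open>\<omega>\<^sub>1\<close>| apart, and
  uniformly discrete sets are closed. Subsets are allowed so that single points can be taken out of
  \<Lambda>.\<close>

lemma sublattice_closed: "A \<subseteq> \<Lambda> \<Longrightarrow> closed A"
proof (rule discrete_imp_closed[of "norm \<omega>\<^sub>1"])
  assume "A \<subseteq> \<Lambda>"
  thus "\<forall>x\<in>A. \<forall>y\<in>A. dist y x < norm \<omega>\<^sub>1 \<longrightarrow> y = x"
    using norm_lattice_ge lattice_diff by (force simp: dist_norm)
qed (use omega1_nonzero in auto)

lemma eventually_not_in_lattice: "eventually (\<lambda>w. w \<notin> \<Lambda>) (at z)"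
proof -
  have "open (- (\<Lambda> - {z}))"
    by (intro open_Compl sublattice_closed) auto
  hence "eventually (\<lambda>w. w \<in> - (\<Lambda> - {z}) - {z}) (at z)"
    by (intro eventually_at_in_open) auto
  thus ?thesis
    by eventually_elim auto
qed

text \<open>Dropping the integer parts of the two real coordinates of \<open>z\<close> moves it into
  a fundamental parallelogram. The compact disc around it serves as a set of representatives modulo
  \<Lambda>.\<close>

lemma lattice_reduce:
  obtains l where "l \<in> \<Lambda>" "norm (z + l) \<le> 2 * norm \<omega>\<^sub>1"
proof -
  \<comment> \<open>\<open>x\<close> and \<open>y\<close> are the real coordinates of
    \<open>z / \<omega>\<^sub>1\<close> in the basis 1, \<omega>.\<close>
  define y where "y = Im (z / \<omega>\<^sub>1) / Im \<omega>"
  define x where "x = Re (z / \<omega>\<^sub>1) - y * Re \<omega>"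
  have "z / \<omega>\<^sub>1 = of_real x + of_real y * \<omega>"
    using Im_omega by (auto simp: complex_eq_iff x_def y_def simp del: Re_divide Im_divide)
  hence z: "z = (of_real x + of_real y * \<omega>) * \<omega>\<^sub>1"
    using omega1_nonzero by (simp add: field_simps)
  define l where "l = of_int (- \<lfloor>x\<rfloor>) * \<omega>\<^sub>1 + of_int (- \<lfloor>y\<rfloor>) * (\<omega> * \<omega>\<^sub>1)"
  have "z + l = (of_real (frac x) + of_real (frac y) * \<omega>) * \<omega>\<^sub>1"
    by (simp add: z l_def frac_def algebra_simps)
  moreover have "norm (of_real (frac x) + of_real (frac y) * \<omega>) \<le> 1 + 1"
    by (rule order.trans[OF norm_triangle_ineq], rule add_mono)
       (auto simp: norm_mult norm_omega frac_ge_0 less_imp_le[OF frac_lt_1])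
  ultimately have "norm (z + l) \<le> 2 * norm \<omega>\<^sub>1"
    by (simp add: norm_mult mult_right_mono)
  thus ?thesis
    using that[of l] lattice_memI unfolding l_def by blast
qed

section \<open>Absolute convergence of the lattice sum with exponent 3\<close>

lemma inverse_cube_summable:
  assumes "A \<subseteq> \<Lambda> - {0}"
  shows "(\<lambda>l. 1 / norm l ^ 3) summable_on A"
proof -
  \<comment> \<open>\<open>norm (m \<omega>\<^sub>1 + n \<omega> \<omega>\<^sub>1)\<^sup>2\<close> dominates \<open>(1 + \<bar>m\<bar>) (1 + \<bar>n\<bar>)\<close>, so the double series
    is bounded by a product of two convergent single series.\<close>
  define u :: "int \<Rightarrow> real" where "u m = (1 + \<bar>of_int m\<bar>) powr (- 3 / 2)" for m
  have u_nonneg: "u m \<ge> 0" for m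
    by (simp add: u_def)
  have nat_sum: "(\<lambda>n. u (int n)) summable_on UNIV"
  proof (rule summable_on_UNIV_nonneg_real_iff[THEN iffD2])
    have "summable (\<lambda>n. real (Suc n) powr (- 3 / 2))"
      by (subst summable_Suc_iff, subst summable_real_powr_iff) simp
    thus "summable (\<lambda>n. u (int n))"
      by (simp add: u_def)
  qed (use u_nonneg in auto)
  have "u summable_on (range int \<union> range (\<lambda>n. - int n))"
  proof (rule summable_on_union)
    show "u summable_on range int" "u summable_on range (\<lambda>n. - int n)"
      using nat_sum by (subst summable_on_reindex; simp add: inj_on_def o_def u_def)+
  qed
  also have "range int \<union> range (\<lambda>n. - int n) = UNIV"
    by (auto simp: image_iff) (metis int_cases2)
  finally have u_sum: "u summable_on UNIV" .
  have "(\<lambda>(m, n). u m * u n) summable_on UNIV \<times> UNIV"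
  proof (rule summable_on_SigmaI)
    show "((\<lambda>n. case (m, n) of (m, n) \<Rightarrow> u m * u n) has_sum u m * (\<Sum>\<^sub>\<infinity>n. u n)) UNIV" for m
      using has_sum_cmult_right[OF has_sum_infsum[OF u_sum]] by simp
    show "(\<lambda>m. u m * (\<Sum>\<^sub>\<infinity>n. u n)) summable_on UNIV"
      by (rule summable_on_cmult_left[OF u_sum])
  qed (auto simp: u_nonneg)
  hence uu: "(\<lambda>(m, n). u m * u n) summable_on B" for B
    by (rule summable_on_subset_banach) auto

  define B where "B = {(m, n). of_int m * \<omega>\<^sub>1 + of_int n * (\<omega> * \<omega>\<^sub>1) \<in> A}"
  define g where "g = (\<lambda>(m, n). of_int m * \<omega>\<^sub>1 + of_int n * (\<omega> * \<omega>\<^sub>1))"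
  have inj: "inj_on g B"
  proof (rule inj_onI, clarify)
    fix m n k j
    assume "g (m, n) = g (k, j)"
    hence "(of_int m - of_int k + (of_int n - of_int j) * \<omega>) * \<omega>\<^sub>1 = 0"
      by (simp add: g_def algebra_simps)
    hence eq: "of_int m - of_int k + (of_int n - of_int j) * \<omega> = 0"
      using omega1_nonzero by simp
    hence "Im (of_int m - of_int k + (of_int n - of_int j) * \<omega>) = 0"
      by simp
    hence "n = j"
      using Im_omega by simp
    with eq show "m = k \<and> n = j"
      by simp
  qed
  have img: "g ` B = A"
  proof
    show "A \<subseteq> g ` B"
    proof
      fix l assume l: "l \<in> A"
      hence "l \<in> \<Lambda>" using assms by auto
      then obtain m n where "l = of_int m * \<omega>\<^sub>1 + of_int n * (\<omega> * \<omega>\<^sub>1)" by (elim lattice_memE)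
      hence "l = g (m, n)" "(m, n) \<in> B" using l by (auto simp: g_def B_def)
      thus "l \<in> g ` B" by blast
    qed
  qed (auto simp: g_def B_def)

  \<comment> \<open>The inequality (1 + |x|) (1 + |y|) \<le> 6 (x^2 - x y + y^2) below is raised to
    the power 3/2; this produces the 6 and turns the squared norm into a cube.\<close>
  define C where "C = 6 powr (3 / 2) / norm \<omega>\<^sub>1 ^ 3"
  have bound: "1 / norm (g (m, n)) ^ 3 \<le> C * (u m * u n)" if "(m, n) \<in> B" for m n
  proof -
    define x y where "x = real_of_int m" and "y = real_of_int n"
    have g: "g (m, n) = of_real x * \<omega>\<^sub>1 + of_real y * (\<omega> * \<omega>\<^sub>1)"
      by (simp add: g_def x_def y_def)
    have "g (m, n) \<in> \<Lambda> - {0}"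
      using that img assms by blast
    hence mn: "m \<noteq> 0 \<or> n \<noteq> 0"
      by (auto simp: g_def)
    have "m\<^sup>2 + n\<^sup>2 > 0"
      using mn by (auto simp: sum_power2_gt_zero_iff)
    hence "real_of_int (m\<^sup>2 + n\<^sup>2) \<ge> 1"
      by linarith
    hence xy: "x\<^sup>2 + y\<^sup>2 \<ge> 1"
      by (simp add: x_def y_def)
    have "(1 + \<bar>x\<bar>) * (1 + \<bar>y\<bar>) \<le> 2 + x\<^sup>2 + y\<^sup>2"
    proof -
      have "0 \<le> (\<bar>x\<bar> - \<bar>y\<bar>)\<^sup>2 + (\<bar>x\<bar> - 1)\<^sup>2 + (\<bar>y\<bar> - 1)\<^sup>2" by simp
      thus ?thesis by (simp add: power2_eq_square algebra_simps)
    qed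
    \<comment> \<open>As x y \<le> (x^2 + y^2) / 2, the right-hand side is at least 3 (x^2 + y^2),
      and x^2 + y^2 \<ge> 1 absorbs the constant 2.\<close>
    also have "\<dots> \<le> 6 * (x\<^sup>2 - x * y + y\<^sup>2)"
    proof -
      have "0 \<le> (x - y)\<^sup>2" by simp
      hence "2 * (x * y) \<le> x\<^sup>2 + y\<^sup>2" by (simp add: power2_eq_square algebra_simps)
      thus ?thesis using xy by argo
    qed
    finally have le: "(1 + \<bar>x\<bar>) * (1 + \<bar>y\<bar>) \<le> 6 * (x\<^sup>2 - x * y + y\<^sup>2)" .
    define N where "N = norm (g (m, n))"
    have "N > 0"
      using \<open>g (m, n) \<in> \<Lambda> - {0}\<close> by (simp add: N_def)
    have w: "norm \<omega>\<^sub>1 > 0"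
      using omega1_nonzero by simp
    have N2: "N\<^sup>2 = (x\<^sup>2 - x * y + y\<^sup>2) * (norm \<omega>\<^sub>1)\<^sup>2"
      by (simp only: N_def g norm_hexagonal)
    have "((1 + \<bar>x\<bar>) * (1 + \<bar>y\<bar>)) powr (3 / 2) \<le> (6 * (N / norm \<omega>\<^sub>1)\<^sup>2) powr (3 / 2)"
      using le w by (intro powr_mono2) (auto simp: power_divide N2)
    also have "\<dots> = 6 powr (3 / 2) * (N / norm \<omega>\<^sub>1) ^ 3"
    proof -
      have p: "N / norm \<omega>\<^sub>1 > 0" using w \<open>N > 0\<close> by simp
      have "((N / norm \<omega>\<^sub>1)\<^sup>2) powr (3 / 2) = (N / norm \<omega>\<^sub>1) powr 3"
        using p by (simp add: powr_powr flip: powr_numeral)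
      thus ?thesis using p by (simp add: powr_mult)
    qed
    also have "\<dots> = C * N ^ 3"
      by (simp add: C_def power_divide)
    finally have "((1 + \<bar>x\<bar>) * (1 + \<bar>y\<bar>)) powr (3 / 2) \<le> C * N ^ 3" .
    moreover have "((1 + \<bar>x\<bar>) * (1 + \<bar>y\<bar>)) powr (3 / 2) * (u m * u n) = 1"
    proof -
      have "(1 + \<bar>x\<bar>) powr (3 / 2) \<noteq> 0" "(1 + \<bar>y\<bar>) powr (3 / 2) \<noteq> 0"
        by auto
      moreover have "(a * b) * (inverse a * inverse b) = 1" if "a \<noteq> 0" "b \<noteq> 0" for a b :: real
        using that by (simp add: field_simps)
      moreover have "u m = inverse ((1 + \<bar>x\<bar>) powr (3 / 2))" "u n = inverse ((1 + \<bar>y\<bar>) powr (3 / 2))"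
        by (simp_all add: u_def x_def y_def powr_minus)
      ultimately show ?thesis
        by (simp only: powr_mult)
    qed
    moreover have "u m * u n \<ge> 0"
      by (simp add: u_nonneg)
    ultimately have "1 \<le> C * N ^ 3 * (u m * u n)"
      by (metis mult_right_mono)
    thus ?thesis
      using \<open>N > 0\<close> by (simp add: N_def[symmetric] field_simps)
  qed
  have "(\<lambda>p. 1 / norm (g p) ^ 3) summable_on B"
  proof (rule summable_on_comparison_test)
    show "(\<lambda>p. C * (case p of (m, n) \<Rightarrow> u m * u n)) summable_on B"
      by (intro summable_on_cmult_right uu)
  qed (use bound in auto)
  thus ?thesis
    unfolding img[symmetric] by (subst summable_on_reindex[OF inj]) (simp add: o_def)
qed


subsection \<open>The derivative of the Weierstrass function\<close>

text \<open>This is \<wp> without its principal part 1/z^2 at 0, hence holomorphic there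
  too.\<close>

definition wp_reg :: "complex \<Rightarrow> complex" where
  "wp_reg w = (\<Sum>\<^sub>\<infinity>l\<in>\<Lambda> - {0}. 1 / (w - l)\<^sup>2 - 1 / l\<^sup>2)"

text \<open>On a small closed disc around \<open>z\<close> the terms are O(1/|l|^3), so the series
  converges uniformly by the M-test and may be differentiated term by term.\<close>

lemma wp_reg_deriv:
  assumes z: "z \<notin> \<Lambda> - {0}"
  obtains d where "(wp_reg has_field_derivative d) (at z)"
    and "((\<lambda>l. - 2 / (z - l) ^ 3) has_sum d) (\<Lambda> - {0})"
proof -
  define A where "A = \<Lambda> - {0}"
  have "open (- A)"
    by (intro open_Compl sublattice_closed) (auto simp: A_def)
  moreover have "z \<in> - A"
    using z unfolding A_def by blast
  ultimately obtain e where e: "e > 0" "ball z e \<subseteq> - A"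
    by (meson openE)
  \<comment> \<open>Halving the radius keeps every point of the closed disc at distance at least
    \<open>r\<close> from all poles.\<close>
  define r where "r = e / 2"
  have r: "r > 0"
    using e by (simp add: r_def)
  have away: "norm (w - l) \<ge> r" if "w \<in> cball z r" "l \<in> A" for w l
  proof -
    have "dist z l \<ge> e"
      using e that(2) by (force simp: subset_iff)
    moreover have "dist z l \<le> dist z w + dist w l"
      by (rule dist_triangle)
    ultimately show ?thesis
      using that(1) by (simp add: r_def dist_norm)
  qed
  have nonzero: "w - l \<noteq> 0" if "w \<in> cball z r" "l \<in> A" for w l
    using away[OF that] r by auto
  define R where "R = norm z + r"
  \<comment> \<open>\<open>K\<close> is chosen so that |l| \<le> K |w - l| on the disc: |l| \<le> R
    + |w - l|, and R \<le> (R / r) |w - l| because |w - l| \<ge> r.\<close>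
  define K where "K = 1 + R / r"
  have R: "R > 0"
    using r by (auto simp: R_def intro: add_nonneg_pos)
  have K: "K > 0"
    using r R by (auto simp: K_def intro: add_pos_pos)
  have bound: "norm (1 / (w - l)\<^sup>2 - 1 / l\<^sup>2) \<le> R * (K\<^sup>2 + K) * (1 / norm l ^ 3)"
    if "l \<in> A" "w \<in> cball z r" for l w
  proof -
    define a b where "a = norm l" and "b = norm (w - l)"
    have l: "l \<noteq> 0"
      using that by (auto simp: A_def)
    have wl: "w - l \<noteq> 0"
      using nonzero that by blast
    have pos: "a > 0" "b > 0"
      using l wl by (auto simp: a_def b_def)
    have wR: "norm w \<le> R"
    proof -
      have "norm w \<le> norm z + norm (w - z)"
        by (metis add.commute diff_add_cancel norm_triangle_ineq)
      thus ?thesis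
        using that(2) by (simp add: R_def dist_norm norm_minus_commute)
    qed
    have "a \<le> norm w + b"
      unfolding a_def b_def by (metis norm_triangle_sub norm_minus_commute add.commute)
    also have "\<dots> \<le> R / r * b + b"
    proof -
      have "R * r \<le> R * b"
        using away that R by (auto simp: b_def)
      hence "R \<le> R / r * b"
        using r by (simp add: pos_le_divide_eq)
      thus ?thesis
        using wR by linarith
    qed
    also have "\<dots> = K * b"
      by (simp add: K_def algebra_simps)
    finally have ab: "1 / b \<le> K / a"
      using pos by (simp add: field_simps)
    \<comment> \<open>Over the common denominator the numerator is only linear in \<open>l\<close>,
      which leaves decay of order |l|^-3.\<close>
    have "1 / (w - l)\<^sup>2 - 1 / l\<^sup>2 = w * (2 * l - w) / (l\<^sup>2 * (w - l)\<^sup>2)"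
      using l wl by (simp add: field_simps) (simp add: power2_eq_square algebra_simps)
    hence "norm (1 / (w - l)\<^sup>2 - 1 / l\<^sup>2) = norm w * norm (2 * l - w) / (a\<^sup>2 * b\<^sup>2)"
      by (simp add: norm_mult norm_divide norm_power a_def b_def)
    also have "\<dots> \<le> R * (a + b) / (a\<^sup>2 * b\<^sup>2)"
    proof (intro divide_right_mono mult_mono)
      have "norm (l - (w - l)) \<le> a + b"
        unfolding a_def b_def by (rule norm_triangle_ineq4)
      thus "norm (2 * l - w) \<le> a + b"
        by (simp add: algebra_simps)
    qed (use wR R in auto)
    also have "\<dots> = R * ((1 / b)\<^sup>2 / a + 1 / b / a\<^sup>2)"
      using pos by (simp add: field_simps power2_eq_square)
    also have "\<dots> \<le> R * ((K / a)\<^sup>2 / a + K / a / a\<^sup>2)"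
      using R pos ab K by (intro mult_left_mono add_mono divide_right_mono power_mono) auto
    also have "\<dots> = R * (K\<^sup>2 + K) * (1 / a ^ 3)"
      using pos by (simp add: field_simps power2_eq_square power3_eq_cube)
    finally show ?thesis
      by (simp add: a_def)
  qed
  define f where "f X w = (\<Sum>l\<in>X. 1 / (w - l)\<^sup>2 - 1 / l\<^sup>2)" for X and w :: complex
  define f' where "f' X w = (\<Sum>l\<in>X. - 2 / (w - l) ^ 3)" for X and w :: complex
  have ulim: "uniform_limit (cball z r) f wp_reg (finite_subsets_at_top A)"
    unfolding f_def[abs_def] wp_reg_def[abs_def] A_def[symmetric]
  proof (rule Weierstrass_m_test_general[OF bound])
    show "(\<lambda>l. R * (K\<^sup>2 + K) * (1 / norm l ^ 3)) summable_on A"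
      by (intro summable_on_cmult_right inverse_cube_summable) (simp add: A_def)
  qed
  have deriv: "(f X has_field_derivative f' X w) (at w)" if X: "X \<subseteq> A" and w: "w \<in> cball z r" for X w
    unfolding f_def[abs_def] f'_def
  proof (rule DERIV_sum)
    fix l assume "l \<in> X"
    hence "w - l \<noteq> 0"
      using X w nonzero by blast
    thus "((\<lambda>w. 1 / (w - l)\<^sup>2 - 1 / l\<^sup>2) has_field_derivative - 2 / (w - l) ^ 3) (at w)"
      by (auto intro!: derivative_eq_intros simp: field_simps) (simp add: eval_nat_numeral algebra_simps)
  qed
  have cont: "eventually (\<lambda>X. continuous_on (cball z r) (f X) \<and>
      (\<forall>w\<in>ball z r. (f X has_field_derivative f' X w) (at w))) (finite_subsets_at_top A)"
  proof (rule eventually_finite_subsets_at_top_weakI)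
    fix X assume "X \<subseteq> A"
    hence "(f X has_field_derivative f' X w) (at w)" if "w \<in> cball z r" for w
      using deriv that by blast
    thus "continuous_on (cball z r) (f X) \<and> (\<forall>w\<in>ball z r. (f X has_field_derivative f' X w) (at w))"
      by (auto intro!: DERIV_isCont continuous_at_imp_continuous_on)
  qed
  \<comment> \<open>The theorem on uniform limits also gives convergence of the differentiated
    partial sums along the finite subsets, which is what \<open>has_sum\<close> means.\<close>
  obtain g' where "\<And>w. w \<in> ball z r \<Longrightarrow>
      (wp_reg has_field_derivative g' w) (at w) \<and> ((\<lambda>X. f' X w) \<longlongrightarrow> g' w) (finite_subsets_at_top A)"
    using has_complex_derivative_uniform_limit[OF cont ulim _ r] by auto
  from this[of z] have "(wp_reg has_field_derivative g' z) (at z)" "((\<lambda>l. - 2 / (z - l) ^ 3) has_sum g' z) A"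
    using r by (simp_all add: has_sum_def f'_def[abs_def])
  thus ?thesis
    using that by (simp add: A_def)
qed

lemma open_lattice_compl: "A \<subseteq> \<Lambda> \<Longrightarrow> open (- A)"
  by (simp add: sublattice_closed open_Compl)

lemma wp_reg_holomorphic: "wp_reg holomorphic_on - (\<Lambda> - {0})"
proof (subst holomorphic_on_open)
  show "open (- (\<Lambda> - {0}))"
    by (rule open_lattice_compl) auto
  show "\<forall>z\<in>- (\<Lambda> - {0}). \<exists>d. (wp_reg has_field_derivative d) (at z)"
    by (metis ComplD wp_reg_deriv)
qed

section \<open>The finite part of \<wp>': series, symmetries and poles\<close>

definition wp_deriv :: "complex \<Rightarrow> complex" where
  "wp_deriv z = (if z \<in> \<Lambda> then 0 else - 2 / z ^ 3 + deriv wp_reg z)"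

lemma weierstrass_p_eq:
  "z \<notin> \<Lambda> \<Longrightarrow> fin_part (weierstrass_p \<Lambda> z) = 1 / z\<^sup>2 + wp_reg z"
  by (simp add: weierstrass_p_def wp_reg_def)

text \<open>So \<open>wp_deriv\<close> is the finite part of \<wp>', with value 0 at the poles as
  for nicely meromorphic functions. Complex analysis is done with \<open>wp_deriv\<close>, and this
  identity carries the results back to the sphere.\<close>

lemma cp1_deriv_weierstrass_p:
  "cp1_deriv (weierstrass_p \<Lambda>) z = (if z \<in> \<Lambda> then Infty else Fin (wp_deriv z))"
proof (cases "z \<in> \<Lambda>")
  case False
  hence "z \<noteq> 0"
    using zero_in_lattice by auto
  obtain d where d: "(wp_reg has_field_derivative d) (at z)"
    using wp_reg_deriv False by auto
  have "((\<lambda>z. 1 / z\<^sup>2) has_field_derivative - 2 / z ^ 3) (at z)"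
    using \<open>z \<noteq> 0\<close> by (auto intro!: derivative_eq_intros simp: field_simps) (simp add: eval_nat_numeral)
  from DERIV_add[OF this d] have "((\<lambda>z. 1 / z\<^sup>2 + wp_reg z) has_field_derivative wp_deriv z) (at z)"
    using False DERIV_imp_deriv[OF d] by (simp add: wp_deriv_def)
  moreover have "eventually (\<lambda>w. fin_part (weierstrass_p \<Lambda> w) = 1 / w\<^sup>2 + wp_reg w) (nhds z)"
  proof (rule eventually_mono[OF eventually_nhds_in_open])
    show "open (- \<Lambda>)" "z \<in> - \<Lambda>"
      using False by (auto intro: open_lattice_compl)
  qed (auto simp: weierstrass_p_eq)
  ultimately have "((\<lambda>z. fin_part (weierstrass_p \<Lambda> z)) has_field_derivative wp_deriv z) (at z)"
    by (subst DERIV_cong_ev[OF refl _ refl])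
  thus ?thesis
    using False by (simp add: cp1_deriv_def weierstrass_p_def DERIV_imp_deriv)
qed (simp add: cp1_deriv_def weierstrass_p_def)

text \<open>The explicit - 2 / z^3 is the term for l = 0. Summing over all of \<Lambda> makes the
  symmetries mere reindexings.\<close>

lemma wp_deriv_has_sum:
  assumes "z \<notin> \<Lambda>"
  shows "((\<lambda>l. - 2 / (z - l) ^ 3) has_sum wp_deriv z) \<Lambda>"
proof -
  obtain d where d: "(wp_reg has_field_derivative d) (at z)"
    and s: "((\<lambda>l. - 2 / (z - l) ^ 3) has_sum d) (\<Lambda> - {0})"
    using wp_reg_deriv assms by blast
  have "((\<lambda>l. - 2 / (z - l) ^ 3) has_sum (- 2 / (z - 0) ^ 3 + d)) (insert 0 (\<Lambda> - {0}))"
    using s by (rule has_sum_insert[rotated]) auto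
  moreover have "insert 0 (\<Lambda> - {0}) = \<Lambda>"
    using zero_in_lattice by auto
  ultimately show ?thesis
    using assms DERIV_imp_deriv[OF d] by (simp add: wp_deriv_def)
qed

lemma wp_deriv_add:
  assumes "l \<in> \<Lambda>" shows "wp_deriv (z + l) = wp_deriv z"
proof (cases "z \<in> \<Lambda>")
  case False
  hence "z + l \<notin> \<Lambda>"
    using assms by (simp add: lattice_add_iff)
  hence "((\<lambda>k. - 2 / (z + l - k) ^ 3) has_sum wp_deriv (z + l)) \<Lambda>"
    by (rule wp_deriv_has_sum)
  also have "?this \<longleftrightarrow> ((\<lambda>k. - 2 / (z - k) ^ 3) has_sum wp_deriv (z + l)) \<Lambda>"
    by (rule has_sum_reindex_bij_witness[where i = "\<lambda>k. k + l" and j = "\<lambda>k. k - l"])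
       (use assms in \<open>auto simp: algebra_simps intro: lattice_add lattice_diff\<close>)
  finally show ?thesis
    using wp_deriv_has_sum[OF False] has_sum_unique by blast
qed (use assms in \<open>simp add: wp_deriv_def lattice_add\<close>)

text \<open>Multiplication by \<omega> permutes \<Lambda>, and the cubes in the denominators absorb
  \<omega> since \<omega>^3 = 1.\<close>

lemma wp_deriv_rotate: "wp_deriv (\<omega> * z) = wp_deriv z"
proof (cases "z \<in> \<Lambda>")
  case False
  hence "\<omega> * z \<notin> \<Lambda>"
    by (simp add: lattice_rotate_iff)
  hence "((\<lambda>k. - 2 / (\<omega> * z - k) ^ 3) has_sum wp_deriv (\<omega> * z)) \<Lambda>"
    by (rule wp_deriv_has_sum)
  also have "?this \<longleftrightarrow> ((\<lambda>k. - 2 / (z - k) ^ 3) has_sum wp_deriv (\<omega> * z)) \<Lambda>"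
  proof (rule sym, rule has_sum_reindex_bij_witness[where i = "\<lambda>k. k / \<omega>" and j = "\<lambda>k. \<omega> * k"])
    fix k
    show "- 2 / (\<omega> * z - \<omega> * k) ^ 3 = - 2 / (z - k) ^ 3"
      by (simp add: right_diff_distrib[symmetric] power_mult_distrib omega_cubed)
    show "k / \<omega> \<in> \<Lambda>" if "k \<in> \<Lambda>"
      using that lattice_rotate_iff[of "k / \<omega>"] omega_nonzero by simp
  qed (use omega_nonzero in \<open>auto intro: lattice_rotate\<close>)
  finally show ?thesis
    using wp_deriv_has_sum[OF False] has_sum_unique by blast
qed (simp add: wp_deriv_def lattice_rotate)

lemma wp_deriv_analytic: "z \<notin> \<Lambda> \<Longrightarrow> wp_deriv analytic_on {z}"
proof -
  assume z: "z \<notin> \<Lambda>"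
  have deriv: "deriv wp_reg holomorphic_on - \<Lambda>"
    by (rule holomorphic_on_subset[OF holomorphic_deriv[OF wp_reg_holomorphic open_lattice_compl]]) auto
  have "(\<lambda>z. - 2 / z ^ 3 + deriv wp_reg z) holomorphic_on - \<Lambda>"
    using zero_in_lattice by (intro holomorphic_on_add[OF _ deriv] holomorphic_intros) auto
  hence "wp_deriv holomorphic_on - \<Lambda>"
    by (rule holomorphic_transform) (simp add: wp_deriv_def)
  thus ?thesis
    using z open_lattice_compl[of \<Lambda>] by (auto simp: analytic_at)
qed

lemma deriv_wp_reg_analytic_0: "deriv wp_reg analytic_on {0}"
proof -
  have "open (- (\<Lambda> - {0}))"
    by (rule open_lattice_compl) auto
  thus ?thesis
    using holomorphic_deriv[OF wp_reg_holomorphic] unfolding analytic_at by blast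
qed

text \<open>Besides locating the pole, the leading coefficient - 2 normalises the powers of \<wp>'
  subtracted in \<open>poles_in_lattice_imp_poly\<close>.\<close>

lemma wp_deriv_cube_tendsto: "(\<lambda>z. z ^ 3 * wp_deriv z) \<midarrow>0\<rightarrow> - 2"
proof -
  have "deriv wp_reg \<midarrow>0\<rightarrow> deriv wp_reg 0"
    using analytic_at_imp_isCont[OF deriv_wp_reg_analytic_0] by (simp add: isCont_def)
  hence "(\<lambda>z. - 2 + z ^ 3 * deriv wp_reg z) \<midarrow>0\<rightarrow> - 2 + 0 ^ 3 * deriv wp_reg 0"
    by (intro tendsto_intros)
  moreover have "eventually (\<lambda>z. - 2 + z ^ 3 * deriv wp_reg z = z ^ 3 * wp_deriv z) (at 0)"
    using eventually_not_in_lattice eventually_neq_at_within[of 0 0]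
    by eventually_elim (simp add: wp_deriv_def field_simps)
  ultimately show ?thesis
    by (simp add: filterlim_cong)
qed

lemma wp_deriv_pole:
  assumes "l \<in> \<Lambda>" shows "is_pole wp_deriv l"
proof -
  have "filterlim (\<lambda>z. z ^ 3 * wp_deriv z / z ^ 3) at_infinity (at 0)"
    by (rule filterlim_divide_at_infinity[OF wp_deriv_cube_tendsto])
       (auto simp: filterlim_at eventually_at_filter intro!: tendsto_eq_intros)
  moreover have "eventually (\<lambda>z. z ^ 3 * wp_deriv z / z ^ 3 = wp_deriv z) (at 0)"
    using eventually_neq_at_within[of 0 0] by eventually_elim auto
  ultimately have "is_pole wp_deriv 0"
    by (simp add: is_pole_def filterlim_cong)
  moreover have "is_pole wp_deriv l \<longleftrightarrow> is_pole (\<lambda>z. wp_deriv (l + z)) 0"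
    by (subst is_pole_shift_0) rule
  ultimately show ?thesis
    using wp_deriv_add[OF assms] by (simp add: add.commute)
qed

lemma wp_deriv_meromorphic: "wp_deriv meromorphic_on A"
proof -
  have "(\<lambda>z. - 2 / z ^ 3 + deriv wp_reg z) meromorphic_on {0}"
    by (intro meromorphic_intros analytic_on_imp_meromorphic_on deriv_wp_reg_analytic_0 analytic_intros)
  moreover have "eventually (\<lambda>z. - 2 / z ^ 3 + deriv wp_reg z = wp_deriv z) (at 0)"
    using eventually_not_in_lattice by eventually_elim (simp add: wp_deriv_def)
  ultimately have 0: "wp_deriv meromorphic_on {0}"
    by (subst (asm) meromorphic_on_cong) auto
  have "wp_deriv meromorphic_on {z}" for z
  proof (cases "z \<in> \<Lambda>")
    case True
    have "(\<lambda>w. wp_deriv (w - z)) meromorphic_on {z}"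
      by (rule meromorphic_on_compose[OF 0]) (auto intro!: analytic_intros)
    also have "(\<lambda>w. wp_deriv (w - z)) = wp_deriv"
      using wp_deriv_add[OF lattice_uminus[OF True]] by auto
    finally show ?thesis .
  qed (auto intro: analytic_on_imp_meromorphic_on wp_deriv_analytic)
  thus ?thesis
    by (subst meromorphic_on_meromorphic_at) auto
qed


subsection \<open>Invariant functions\<close>

text \<open>The bijections fixing \<open>f\<close> under precomposition are closed under composition
  and inverses, so checking the generators suffices.\<close>

lemma invariant_under_p3_group:
  "invariant_under (p3_group \<omega> \<Lambda>) f \<longleftrightarrow> (\<forall>l\<in>\<Lambda>. \<forall>z. f (z + l) = f z) \<and> (\<forall>z. f (\<omega> * z) = f z)"
proof
  define H where "H = {(\<lambda>z. z + l) | l. l \<in> \<Lambda>} \<union> {\<lambda>z. \<omega> * z}"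
  assume *: "(\<forall>l\<in>\<Lambda>. \<forall>z. f (z + l) = f z) \<and> (\<forall>z. f (\<omega> * z) = f z)"
  \<comment> \<open>Membership in \<open>Bij UNIV\<close> is carried along because the product and
    inverse of \<open>BijGroup\<close> are described only for bijections.\<close>
  have H: "h \<in> Bij UNIV \<and> (\<forall>z. f (h z) = f z)" if "h \<in> H" for h
  proof -
    have "bij (\<lambda>z. z + l)" for l :: complex
      by (rule bij_betwI[where g = "\<lambda>z. z - l"]) auto
    moreover have "bij (\<lambda>z. \<omega> * z)"
      using omega_nonzero by (intro bij_betwI[where g = "\<lambda>z. z / \<omega>"]) auto
    ultimately show ?thesis
      using that * by (auto simp: H_def Bij_def)
  qed
  have "g \<in> Bij UNIV \<and> (\<forall>z. f (g z) = f z)" if "g \<in> generate (BijGroup UNIV) H" for g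
    using that
  proof (induction rule: generate.induct)
    case one
    show ?case
      by (simp add: BijGroup_def Bij_def bij_betw_def)
  next
    case (incl h)
    thus ?case
      by (rule H)
  next
    case (inv h)
    hence h: "h \<in> Bij UNIV" "\<And>z. f (h z) = f z"
      using H by auto
    have "inv\<^bsub>BijGroup UNIV\<^esub> h = inv_into UNIV h"
      using inv_BijGroup[OF h(1)] by (simp add: restrict_def)
    moreover have "h (inv_into UNIV h z) = z" for z
      using h(1) by (simp add: Bij_def bij_is_surj surj_f_inv_f)
    hence "f (inv_into UNIV h z) = f z" for z
      using h(2)[of "inv_into UNIV h z"] by simp
    moreover have "inv_into UNIV h \<in> Bij UNIV"
      using restrict_inv_into_Bij[OF h(1)] by (simp add: restrict_def)
    ultimately show ?case
      by simp
  next
    case (eng g h)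
    hence "g \<otimes>\<^bsub>BijGroup UNIV\<^esub> h = compose UNIV g h"
      by (simp add: BijGroup_def)
    thus ?case
      using eng.IH compose_Bij[of g UNIV h] by (simp add: compose_def restrict_def)
  qed
  thus "invariant_under (p3_group \<omega> \<Lambda>) f"
    by (simp add: invariant_under_def p3_group_def H_def)
next
  assume "invariant_under (p3_group \<omega> \<Lambda>) f"
  hence inv: "f (g z) = f z" if "g \<in> p3_group \<omega> \<Lambda>" for g z
    using that by (simp add: invariant_under_def)
  have trans: "(\<lambda>z. z + l) \<in> p3_group \<omega> \<Lambda>" if "l \<in> \<Lambda>" for l
    unfolding p3_group_def by (rule generate.incl) (use that in auto)
  have rot: "(\<lambda>z. \<omega> * z) \<in> p3_group \<omega> \<Lambda>"
    unfolding p3_group_def by (rule generate.incl) auto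
  show "(\<forall>l\<in>\<Lambda>. \<forall>z. f (z + l) = f z) \<and> (\<forall>z. f (\<omega> * z) = f z)"
    using inv[OF trans] inv[OF rot] by simp
qed

section \<open>Rational functions of \<wp>' are meromorphic into the sphere\<close>

lemma poly_wp_deriv_eventually_nonzero:
  assumes "q \<noteq> 0"
  shows "eventually (\<lambda>w. poly q (wp_deriv w) \<noteq> 0) (at z)"
proof -
  have "(\<lambda>w. poly q (wp_deriv w)) meromorphic_on UNIV"
    by (intro meromorphic_intros wp_deriv_meromorphic)
  then consider "eventually (\<lambda>w. poly q (wp_deriv w) = 0) (cosparse UNIV)"
    | "eventually (\<lambda>w. poly q (wp_deriv w) \<noteq> 0) (cosparse UNIV)"
    using meromorphic_imp_constant_or_avoid[of _ UNIV 0] by auto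
  thus ?thesis
  proof cases
    \<comment> \<open>Vanishing identically is impossible: near 0 the values of \<wp>' tend to
      infinity, where a nonzero polynomial has no roots.\<close>
    case 1
    hence "eventually (\<lambda>w. poly q (wp_deriv w) = 0) (at 0)"
      by (rule eventually_cosparse_imp_eventually_at) auto
    moreover have "eventually (\<lambda>w. poly q (wp_deriv w) \<noteq> 0) (at 0)"
      using eventually_poly_nonzero_at_infinity[OF assms] wp_deriv_pole[OF zero_in_lattice]
      unfolding is_pole_def by (rule eventually_compose_filterlim)

    ultimately have "eventually (\<lambda>w. False) (at (0 :: complex))"
      by eventually_elim auto
    thus ?thesis
      by simp
  next
    case 2
    thus ?thesis
      by (rule eventually_cosparse_imp_eventually_at) auto
  qed
qed

lemma rat_eval_wp_deriv:
  assumes "quot_of_fract R = (p, q)" "z \<notin> \<Lambda>"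
  shows "rat_eval R (cp1_deriv (weierstrass_p \<Lambda>) z) =
    (if poly q (wp_deriv z) = 0 then Infty else Fin (poly p (wp_deriv z) / poly q (wp_deriv z)))"
  using assms by (simp add: rat_eval_def cp1_deriv_weierstrass_p)

lemma eventually_fin_part_rat_eval:
  assumes "quot_of_fract R = (p, q)"
  shows "eventually (\<lambda>z. poly p (wp_deriv z) / poly q (wp_deriv z) =
           fin_part (rat_eval R (cp1_deriv (weierstrass_p \<Lambda>) z))) (at z0)"
  using eventually_not_in_lattice by eventually_elim (simp add: rat_eval_wp_deriv[OF assms])

lemma rat_eval_wp_deriv_cp1_meromorphic:
  "cp1_meromorphic (\<lambda>z. rat_eval R (cp1_deriv (weierstrass_p \<Lambda>) z))"
proof -
  obtain p q where pq: "quot_of_fract R = (p, q)"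
    by (cases "quot_of_fract R") auto
  have q: "q \<noteq> 0"
    using snd_quot_of_fract_nonzero[of R] by (simp add: pq)
  have cop: "coprime p q"
    using coprime_quot_of_fract[of R] by (simp add: pq)
  define F where "F = (\<lambda>z. rat_eval R (cp1_deriv (weierstrass_p \<Lambda>) z))"
  define r where "r = (\<lambda>z. poly p (wp_deriv z) / poly q (wp_deriv z))"
  have r: "eventually (\<lambda>w. r w = fin_part (F w)) (at z)" for z
    unfolding r_def F_def using eventually_fin_part_rat_eval[OF pq] by simp
  have "r meromorphic_on UNIV"
    unfolding r_def by (intro meromorphic_intros wp_deriv_meromorphic)
  hence mero: "(\<lambda>z. fin_part (F z)) meromorphic_on UNIV"
    using r by (subst (asm) meromorphic_on_cong) auto
  \<comment> \<open>At every point the value of \<open>F\<close> is the one that \<open>r\<close>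
    dictates nearby. Lattice points need p/q at infinity, zeros of \<open>q\<close> give poles, and
    elsewhere \<open>r\<close> is continuous.\<close>
  have local: "F z = Infty \<and> is_pole r z \<or> (\<exists>c. F z = Fin c \<and> r \<midarrow>z\<rightarrow> c)" for z
  proof (cases "z \<in> \<Lambda>")
    case True
    have lim: "filterlim wp_deriv at_infinity (at z)"
      using wp_deriv_pole[OF True] by (simp add: is_pole_def)
    show ?thesis
    proof (cases "degree p > degree q")
      case deg: True
      have "is_pole r z"
        unfolding is_pole_def r_def
        using poly_divide_filterlim_at_infinity[OF deg q] lim by (rule filterlim_compose)
      thus ?thesis
        using True deg by (simp add: F_def rat_eval_def pq cp1_deriv_weierstrass_p)
    next
      case False
      hence "r \<midarrow>z\<rightarrow> coeff p (degree q) / lead_coeff q"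
        unfolding r_def
        using poly_divide_tendsto_at_infinity[OF _ q] lim by (intro filterlim_compose[OF _ lim]) auto
      thus ?thesis
        using True False by (simp add: F_def rat_eval_def pq cp1_deriv_weierstrass_p)
    qed
  next
    case False
    have cont: "isCont (\<lambda>z. poly s (wp_deriv z)) z" for s
      by (intro isCont_o2[OF analytic_at_imp_isCont[OF wp_deriv_analytic[OF False]]]) auto
    show ?thesis
    proof (cases "poly q (wp_deriv z) = 0")
      case True
      \<comment> \<open>Coprimality excludes the indeterminate case 0/0, so a zero of the
        denominator is a genuine pole.\<close>
      have "poly p (wp_deriv z) \<noteq> 0"
      proof
        assume "poly p (wp_deriv z) = 0"
        with True have "[:- wp_deriv z, 1:] dvd p" "[:- wp_deriv z, 1:] dvd q"
          by (simp_all add: poly_eq_0_iff_dvd)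
        hence "is_unit [:- wp_deriv z, 1:]"
          using cop by (rule coprime_common_divisor[rotated])
        thus False
          by (simp add: is_unit_iff_degree)
      qed
      moreover have "filterlim (\<lambda>z. poly q (wp_deriv z)) (at 0) (at z)"
        using poly_wp_deriv_eventually_nonzero[OF q] cont[of q] True
        by (simp add: filterlim_at isCont_def)
      ultimately have "is_pole r z"
        unfolding r_def by (intro is_pole_divide cont)
      thus ?thesis
        using True False by (simp add: F_def rat_eval_wp_deriv[OF pq])
    next
      case nz: False
      have "r \<midarrow>z\<rightarrow> poly p (wp_deriv z) / poly q (wp_deriv z)"
        unfolding r_def using cont nz by (intro tendsto_divide) (auto simp: isCont_def)
      thus ?thesis
        using nz False by (simp add: F_def rat_eval_wp_deriv[OF pq])
    qed
  qed
  have pole_r: "is_pole r z \<longleftrightarrow> is_pole (\<lambda>z. fin_part (F z)) z" for z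
    using r by (rule is_pole_cong) auto
  have lim_r: "r \<midarrow>z\<rightarrow> c \<longleftrightarrow> (\<lambda>z. fin_part (F z)) \<midarrow>z\<rightarrow> c" for z c
    using r by (rule tendsto_cong)
  have excl: "\<not> (is_pole (\<lambda>z. fin_part (F z)) z \<and> (\<lambda>z. fin_part (F z)) \<midarrow>z\<rightarrow> c)" for z c
    by (auto simp: is_pole_def dest: not_tendsto_and_filterlim_at_infinity[rotated])
  have "(\<lambda>z. fin_part (F z)) nicely_meromorphic_on UNIV"
    unfolding nicely_meromorphic_on_def
  proof (intro conjI ballI mero)
    fix z
    show "is_pole (\<lambda>z. fin_part (F z)) z \<and> fin_part (F z) = 0 \<or> (\<lambda>z. fin_part (F z)) \<midarrow>z\<rightarrow> fin_part (F z)"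
      using local[of z] by (auto simp: pole_r lim_r)
  qed
  moreover have "F z = Infty \<longleftrightarrow> is_pole (\<lambda>z. fin_part (F z)) z" for z
    using local[of z] excl[of z] by (auto simp: pole_r lim_r)
  ultimately show ?thesis
    by (simp add: cp1_meromorphic_def F_def)
qed

section \<open>Reducing invariant functions to polynomials in \<wp>'\<close>

lemma is_pole_periodic:
  assumes "\<And>l z. l \<in> \<Lambda> \<Longrightarrow> g (z + l) = g z" and "l \<in> \<Lambda>"
  shows "is_pole g (z + l) \<longleftrightarrow> is_pole (g :: complex \<Rightarrow> complex) z"
proof -
  have "is_pole g (z + l) \<longleftrightarrow> is_pole (g \<circ> (+) l) z"
    by (rule is_pole_shift_iff[symmetric])
  also have "g \<circ> (+) l = g"
    using assms(1)[OF assms(2)] by (simp add: fun_eq_iff add.commute[of l])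
  finally show ?thesis .
qed

text \<open>After removing singularities the function is entire, and by periodicity it takes all its
  values on a compact disc, so Liouville applies. At removable singularities \<open>g\<close> may
  differ from the constant, hence the eventual form.\<close>

lemma periodic_no_poles_imp_constant:
  assumes mero: "g meromorphic_on UNIV" and per: "\<And>l z. l \<in> \<Lambda> \<Longrightarrow> g (z + l) = g z"
    and no_pole: "\<And>z. \<not> is_pole g z"
  obtains c where "\<And>z. eventually (\<lambda>w. g w = c) (at z)"
proof -
  define h where "h = remove_sings g"
  have iso: "isolated_singularity_at g z" for z
    using mero by (simp add: meromorphic_on_altdef)
  have "h analytic_on UNIV"
    unfolding h_def
    by (intro nicely_meromorphic_without_singularities remove_sings_nicely_meromorphic mero ballI)
       (simp add: no_pole iso)
  hence holo: "h holomorphic_on UNIV"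
    by (rule analytic_imp_holomorphic)
  have h_per: "h (z + l) = h z" if "l \<in> \<Lambda>" for z l
  proof -
    have "h (z + l) = remove_sings (\<lambda>w. g (z + w + l)) 0"
      unfolding h_def by (subst remove_sings_shift_0) (simp add: add_ac)
    also have "(\<lambda>w. g (z + w + l)) = (\<lambda>w. g (z + w))"
      using per[OF that] by simp
    also have "remove_sings \<dots> 0 = h z"
      unfolding h_def by (rule remove_sings_shift_0[symmetric])
    finally show ?thesis .
  qed
  have "bounded (h ` cball 0 (2 * norm \<omega>\<^sub>1))"
    by (intro compact_imp_bounded compact_continuous_image holomorphic_on_imp_continuous_on
          holomorphic_on_subset[OF holo]) auto
  moreover have "range h \<subseteq> h ` cball 0 (2 * norm \<omega>\<^sub>1)"
  proof safe
    fix z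
    obtain l where "l \<in> \<Lambda>" "norm (z + l) \<le> 2 * norm \<omega>\<^sub>1"
      by (rule lattice_reduce)
    thus "h z \<in> h ` cball 0 (2 * norm \<omega>\<^sub>1)"
      by (intro image_eqI[of _ _ "z + l"]) (auto simp: h_per)
  qed
  ultimately have "h constant_on UNIV"
    using holo by (intro Liouville_theorem) (auto intro: bounded_subset)
  then obtain c where "\<And>z. h z = c"
    by (auto simp: constant_on_def)
  hence "eventually (\<lambda>w. g w = c) (at z)" for z
    using eventually_remove_sings_eq_at[OF iso[of z]] by (auto simp: h_def elim: eventually_mono)
  thus ?thesis
    by (rule that)
qed

lemma rotation_invariant_pole_order:
  assumes mero: "g meromorphic_on {0}" and rot: "\<And>z. g (\<omega> * z) = g z"
    and lim: "(\<lambda>z. z ^ (3 * Suc k) * g z) \<midarrow>0\<rightarrow> 0"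
  obtains c where "(\<lambda>z. z ^ (3 * k) * g z) \<midarrow>0\<rightarrow> c"
proof (cases "eventually (\<lambda>z. g z = 0) (at 0)")
  case True
  hence "(\<lambda>z. z ^ (3 * k) * g z) \<midarrow>0\<rightarrow> 0"
    by (intro tendsto_eventually) (auto elim: eventually_mono)
  thus ?thesis
    by (rule that)
next
  case False
  hence freq: "\<exists>\<^sub>F z in at 0. g z \<noteq> 0"
    by (simp add: frequently_def)
  define n h where "n = zorder g 0" and "h = zor_poly g 0"
  obtain r where h0: "h 0 \<noteq> 0" and r: "r > 0" "h holomorphic_on cball 0 r"
      and eq: "\<And>w. w \<in> cball 0 r - {0} \<Longrightarrow> g w = h w * w powi n"
    using zorder_exist[OF _ _ freq] mero unfolding n_def h_def meromorphic_at_iff by auto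
  have "h holomorphic_on ball 0 r"
    using r(2) by (rule holomorphic_on_subset) auto
  hence "isCont h 0"
    using r(1) by (meson analytic_at analytic_at_imp_isCont centre_in_ball open_ball)
  hence h_lim: "h \<midarrow>0\<rightarrow> h 0" and h_rot_lim: "(\<lambda>w. h (\<omega> * w)) \<midarrow>0\<rightarrow> h 0"
    by (auto simp: isCont_def intro!: isCont_tendsto_compose[of 0 h] tendsto_eq_intros)
  have "eventually (\<lambda>w. w \<in> ball 0 r - {0}) (at (0 :: complex))"
    using r(1) by (intro eventually_at_in_open) auto
  hence near: "eventually (\<lambda>w. w \<in> cball 0 r - {0}) (at (0 :: complex))"
    by (rule eventually_mono) auto

  \<comment> \<open>Comparing leading coefficients of \<open>g z\<close> and \<open>g (\<omega> z)\<close> shows that the order of \<open>g\<close> at 0 is a multiple of 3.\<close>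
  have "\<omega> powi n = 1"
  proof -
    have "eventually (\<lambda>w. \<omega> powi n * h (\<omega> * w) = h w) (at 0)"
      using near
    proof eventually_elim
      case (elim w)
      hence "\<omega> * w \<in> cball 0 r - {0}"
        using omega_nonzero by (auto simp: norm_mult norm_omega)
      hence "g w = h (\<omega> * w) * (\<omega> powi n * w powi n)"
        using rot[of w] by (simp add: eq power_int_mult_distrib)
      hence "h w * w powi n = \<omega> powi n * h (\<omega> * w) * w powi n"
        using eq[OF elim] by (simp only: mult_ac)
      thus ?case
        using elim by auto
    qed
    moreover have "(\<lambda>w. \<omega> powi n * h (\<omega> * w)) \<midarrow>0\<rightarrow> \<omega> powi n * h 0"
      by (intro tendsto_intros h_rot_lim)
    ultimately have "h \<midarrow>0\<rightarrow> \<omega> powi n * h 0"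
      by (rule Lim_transform_eventually[rotated])
    hence "\<omega> powi n * h 0 = h 0"
      using h_lim by (rule LIM_unique)
    thus ?thesis
      using h0 by simp
  qed
  \<comment> \<open>\<omega> has order exactly 3, so remainders 1 and 2 are excluded.\<close>
  have "3 dvd n"
  proof -
    have "\<omega> powi n = \<omega> powi (3 * (n div 3) + n mod 3)"
      by simp
    also have "\<dots> = (\<omega> powi 3) powi (n div 3) * \<omega> powi (n mod 3)"
      by (simp only: power_int_add[OF disjI1[OF omega_nonzero]] power_int_mult)
    also have "\<omega> powi 3 = 1"
      by (simp add: omega_cubed)
    finally have "\<omega> powi (n mod 3) = 1"
      using \<open>\<omega> powi n = 1\<close> by simp
    moreover have "n mod 3 = 0 \<or> n mod 3 = 1 \<or> n mod 3 = 2"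
      by presburger
    moreover have "\<omega>\<^sup>2 \<noteq> 1"
      using omega_cubed omega_neq_1 by (auto simp: power3_eq_cube power2_eq_square)
    ultimately show ?thesis
      using omega_neq_1 by (auto simp: power_int_def)
  qed
  \<comment> \<open>The limit 0 makes the inequality strict: otherwise multiplying by z^j with j
    \<ge> 0 cancels the power exactly and forces h(0) = 0.\<close>
  have "n + 3 * int (Suc k) > 0"
  proof (rule ccontr)
    assume neg: "\<not> ?thesis"
    define j where "j = nat (- (n + 3 * int (Suc k)))"
    have "(\<lambda>z. z ^ j * (z ^ (3 * Suc k) * g z)) \<midarrow>0\<rightarrow> 0 ^ j * 0"
      by (intro tendsto_intros lim)
    moreover have "eventually (\<lambda>z. z ^ j * (z ^ (3 * Suc k) * g z) = h z) (at 0)"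
      using near
    proof eventually_elim
      case (elim w)
      have "w ^ j * (w ^ (3 * Suc k) * g w) = h w * (w powi int j * w powi int (3 * Suc k) * w powi n)"
        by (simp only: eq[OF elim] power_int_of_nat mult_ac)
      also have "w powi int j * w powi int (3 * Suc k) * w powi n = w powi (int j + int (3 * Suc k) + n)"
        using elim by (simp add: power_int_add)
      also have "int j + int (3 * Suc k) + n = 0"
        using neg by (simp add: j_def)
      finally show ?case
        by simp
    qed
    ultimately have "h \<midarrow>0\<rightarrow> 0 ^ j * 0"
      by (rule Lim_transform_eventually)
    hence "h 0 = 0"
      using h_lim LIM_unique by fastforce
    thus False
      using h0 by simp
  qed
  \<comment> \<open>A multiple of 3 above - 3 (k + 1) is at least - 3 k; this is the gain of 3 in
    the pole order.\<close>
  hence n: "n + 3 * int k \<ge> 0"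
    using \<open>3 dvd n\<close> by presburger
  define m where "m = nat (n + 3 * int k)"
  have "(\<lambda>z. h z * z ^ m) \<midarrow>0\<rightarrow> h 0 * 0 ^ m"
    by (intro tendsto_intros h_lim)
  moreover have "eventually (\<lambda>z. h z * z ^ m = z ^ (3 * k) * g z) (at 0)"
    using near
  proof eventually_elim
    case (elim w)
    have "w ^ (3 * k) * g w = h w * (w powi int (3 * k) * w powi n)"
      by (simp only: eq[OF elim] power_int_of_nat mult_ac)
    also have "w powi int (3 * k) * w powi n = w powi (int (3 * k) + n)"
      using elim by (simp add: power_int_add)
    also have "int (3 * k) + n = int m"
      using n by (simp add: m_def)
    finally show ?case
      by simp
  qed
  ultimately have "(\<lambda>z. z ^ (3 * k) * g z) \<midarrow>0\<rightarrow> h 0 * 0 ^ m"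
    by (rule Lim_transform_eventually)
  thus ?thesis
    by (rule that)
qed

text \<open>The limit \<open>c\<close> may be 0, so \<open>3 * k\<close> only bounds the pole order
  at 0. Periodicity transfers what happens at 0 to all of \<Lambda>.\<close>

lemma poles_in_lattice_imp_poly:
  assumes "g meromorphic_on UNIV" "\<And>l z. l \<in> \<Lambda> \<Longrightarrow> g (z + l) = g z" "\<And>z. g (\<omega> * z) = g z"
    and "\<And>z. z \<notin> \<Lambda> \<Longrightarrow> \<not> is_pole g z"
    and "(\<lambda>z. z ^ (3 * k) * g z) \<midarrow>0\<rightarrow> c"
  shows "\<exists>p. \<forall>z. eventually (\<lambda>w. g w = poly p (wp_deriv w)) (at z)"
  using assms
proof (induction k arbitrary: g c)
  case 0
  have "\<not> is_pole g 0"
    using 0(5) unfolding is_pole_def by (auto dest: not_tendsto_and_filterlim_at_infinity[rotated])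
  hence "\<not> is_pole g l" if "l \<in> \<Lambda>" for l
    using is_pole_periodic[OF 0(2) that, of 0] by simp
  hence "\<not> is_pole g z" for z
    using 0(4) by blast
  then obtain d where "\<And>z. eventually (\<lambda>w. g w = d) (at z)"
    using periodic_no_poles_imp_constant[OF 0(1,2)] by blast
  thus ?case
    by (intro exI[of _ "[:d:]"]) simp
next
  case (Suc k)
  \<comment> \<open>Since z^3 \<wp>'(z) tends to - 2, this coefficient makes the leading terms of
    order 3 (k + 1) cancel.\<close>
  define a where "a = c / (- 2) ^ Suc k"
  define g' where "g' z = g z - a * wp_deriv z ^ Suc k" for z
  have mero: "g' meromorphic_on UNIV"
    unfolding g'_def[abs_def] by (intro meromorphic_intros Suc.prems(1) wp_deriv_meromorphic)
  have "(\<lambda>z. z ^ (3 * Suc k) * g z - a * (z ^ 3 * wp_deriv z) ^ Suc k) \<midarrow>0\<rightarrow> c - a * (- 2) ^ Suc k"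
    by (intro tendsto_intros Suc.prems(5) wp_deriv_cube_tendsto)
  also have "c - a * (- 2) ^ Suc k = 0"
    by (simp add: a_def)
  also have "(\<lambda>z. z ^ (3 * Suc k) * g z - a * (z ^ 3 * wp_deriv z) ^ Suc k) = (\<lambda>z. z ^ (3 * Suc k) * g' z)"
    unfolding g'_def power_mult_distrib power_mult by (simp only: algebra_simps)
  finally have lim: "(\<lambda>z. z ^ (3 * Suc k) * g' z) \<midarrow>0\<rightarrow> 0" .
  have rot: "g' (\<omega> * z) = g' z" for z
    by (simp add: g'_def Suc.prems(3) wp_deriv_rotate)
  obtain c' where c': "(\<lambda>z. z ^ (3 * k) * g' z) \<midarrow>0\<rightarrow> c'"
    using rotation_invariant_pole_order[OF meromorphic_on_subset[OF mero] rot lim] by auto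
  have "\<exists>p. \<forall>z. eventually (\<lambda>w. g' w = poly p (wp_deriv w)) (at z)"
  proof (rule Suc.IH[OF mero _ rot _ c'])
    show "g' (z + l) = g' z" if "l \<in> \<Lambda>" for l z
      using that by (simp add: g'_def Suc.prems(2) wp_deriv_add)
    show "\<not> is_pole g' z" if z: "z \<notin> \<Lambda>" for z
    proof -
      obtain b where "g \<midarrow>z\<rightarrow> b"
        using Suc.prems(1) Suc.prems(4)[OF z] by (auto simp: meromorphic_on_altdef not_essential_def)
      hence "g' \<midarrow>z\<rightarrow> b - a * wp_deriv z ^ Suc k"
        unfolding g'_def[abs_def]
        using analytic_at_imp_isCont[OF wp_deriv_analytic[OF z]]
        by (intro tendsto_intros) (auto simp: isCont_def)
      thus ?thesis
        unfolding is_pole_def by (meson not_tendsto_and_filterlim_at_infinity trivial_limit_at)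
    qed
  qed
  then obtain p where p: "\<And>z. eventually (\<lambda>w. g' w = poly p (wp_deriv w)) (at z)"
    by blast
  have "eventually (\<lambda>w. g w = poly (p + monom a (Suc k)) (wp_deriv w)) (at z)" for z
    using p[of z] by eventually_elim (simp add: g'_def poly_monom algebra_simps)
  thus ?case
    by blast
qed

text \<open>The factor \<wp>' - \<wp>'(s) vanishes at \<open>s\<close>, so a high enough power of it
  cancels the pole there. Finitely many \<open>s\<close> suffice because poles are isolated and the
  disc of representatives is compact.\<close>

lemma clear_poles:
  assumes mero: "f meromorphic_on UNIV" and per: "\<And>l z. l \<in> \<Lambda> \<Longrightarrow> f (z + l) = f z"
  obtains q where "q \<noteq> 0" "\<And>z. z \<notin> \<Lambda> \<Longrightarrow> \<not> is_pole (\<lambda>w. poly q (wp_deriv w) * f w) z"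
proof -
  define K :: "complex set" where "K = cball 0 (2 * norm \<omega>\<^sub>1)"
  define S where "S = {s \<in> K. is_pole f s} - \<Lambda>"
  have "{z. is_pole f z} sparse_in UNIV"
    using meromorphic_on_imp_not_pole_cosparse[OF mero] by (simp add: eventually_cosparse)
  hence "{z. is_pole f z} sparse_in K"
    by (rule sparse_in_subset) auto
  hence "finite (K \<inter> {z. is_pole f z})"
    by (rule sparse_in_compact_finite) (auto simp: K_def)
  hence S: "finite S"
    by (rule finite_subset[rotated]) (auto simp: S_def)
  have "\<forall>s. \<exists>N c. (\<lambda>z. (z - s) ^ N * f z) \<midarrow>s\<rightarrow> c"
    using meromorphic_imp_tendsto_power_mult[OF meromorphic_on_subset[OF mero]] by blast
  then obtain N c where Nc: "\<And>s. (\<lambda>z. (z - s) ^ N s * f z) \<midarrow>s\<rightarrow> c s"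
    by metis
  define q where "q = (\<Prod>s\<in>S. [:- wp_deriv s, 1:] ^ N s)"
  have q: "q \<noteq> 0"
    using S by (auto simp: q_def)
  define g where "g = (\<lambda>w. poly q (wp_deriv w) * f w)"
  have g_per: "g (z + l) = g z" if "l \<in> \<Lambda>" for z l
    using that by (simp add: g_def per wp_deriv_add)
  have "\<exists>b. g \<midarrow>s\<rightarrow> b" if s: "s \<in> K" "s \<notin> \<Lambda>" for s
  proof (cases "s \<in> S")
    case True
    have cont: "wp_deriv \<midarrow>s\<rightarrow> wp_deriv s"
      using analytic_at_imp_isCont[OF wp_deriv_analytic[OF s(2)]] by (simp add: isCont_def)
    have "(wp_deriv has_field_derivative deriv wp_deriv s) (at s)"
      using analytic_on_imp_differentiable_at[OF wp_deriv_analytic[OF s(2)]]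
      by (simp add: DERIV_deriv_iff_field_differentiable)
    hence deriv: "(\<lambda>z. (wp_deriv z - wp_deriv s) / (z - s)) \<midarrow>s\<rightarrow> deriv wp_deriv s"
      by (simp add: has_field_derivative_iff)
    define q' where "q' = (\<Prod>t\<in>S - {s}. [:- wp_deriv t, 1:] ^ N t)"
    have "q = [:- wp_deriv s, 1:] ^ N s * q'"
      unfolding q_def q'_def by (rule prod.remove[OF S True])
    hence g: "g z = (wp_deriv z - wp_deriv s) ^ N s * poly q' (wp_deriv z) * f z" for z
      by (simp add: g_def)
    \<comment> \<open>Each factor \<wp>' - \<wp>'(s) is paired with one z - s to form a difference
      quotient, whose limit \<wp>''(s) is finite, possibly 0.\<close>
    have "(\<lambda>z. ((wp_deriv z - wp_deriv s) / (z - s)) ^ N s * poly q' (wp_deriv z) * ((z - s) ^ N s * f z))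
             \<midarrow>s\<rightarrow> deriv wp_deriv s ^ N s * poly q' (wp_deriv s) * c s"
      by (intro tendsto_intros deriv cont Nc)
    moreover have "eventually (\<lambda>z. ((wp_deriv z - wp_deriv s) / (z - s)) ^ N s * poly q' (wp_deriv z) *
                     ((z - s) ^ N s * f z) = g z) (at s)"
      using eventually_neq_at_within[of s s]
      by eventually_elim (simp add: g power_divide)
    ultimately show ?thesis
      by (blast intro: Lim_transform_eventually)
  next
    case False
    hence "\<not> is_pole f s"
      using s by (simp add: S_def)
    then obtain b where "f \<midarrow>s\<rightarrow> b"
      using mero by (auto simp: meromorphic_on_altdef not_essential_def)
    hence "g \<midarrow>s\<rightarrow> poly q (wp_deriv s) * b"
      unfolding g_def using analytic_at_imp_isCont[OF wp_deriv_analytic[OF s(2)]]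
      by (intro tendsto_intros) (auto simp: isCont_def)
    thus ?thesis
      by blast
  qed
  hence no_pole: "\<not> is_pole g s" if "s \<in> K" "s \<notin> \<Lambda>" for s
    using that unfolding is_pole_def by (meson not_tendsto_and_filterlim_at_infinity trivial_limit_at)
  have "\<not> is_pole g z" if "z \<notin> \<Lambda>" for z
  proof -
    obtain l where "l \<in> \<Lambda>" "z + l \<in> K"
      using lattice_reduce[of z] by (auto simp: K_def)
    thus ?thesis
      using no_pole[of "z + l"] that is_pole_periodic[of g l z] g_per by (simp add: lattice_add_iff)
  qed
  thus ?thesis
    using that q unfolding g_def by blast
qed

section \<open>Both directions of the characterisation\<close>

theorem p3_invariant_iff_rational:
  "cp1_meromorphic f \<and> invariant_under (p3_group \<omega> \<Lambda>) f \<longleftrightarrow>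
     (\<exists>R. f = (\<lambda>z. rat_eval R (cp1_deriv (weierstrass_p \<Lambda>) z)))"
proof safe
  fix R :: "complex poly fract"
  show "cp1_meromorphic (\<lambda>z. rat_eval R (cp1_deriv (weierstrass_p \<Lambda>) z))"
    by (rule rat_eval_wp_deriv_cp1_meromorphic)
  show "invariant_under (p3_group \<omega> \<Lambda>) (\<lambda>z. rat_eval R (cp1_deriv (weierstrass_p \<Lambda>) z))"
    by (simp add: invariant_under_p3_group cp1_deriv_weierstrass_p wp_deriv_add wp_deriv_rotate
          lattice_add_iff lattice_rotate_iff)
next
  assume f: "cp1_meromorphic f" and inv: "invariant_under (p3_group \<omega> \<Lambda>) f"
  define F where "F z = fin_part (f z)" for z
  have mero: "F meromorphic_on UNIV"
    using f by (simp add: cp1_meromorphic_def nicely_meromorphic_on_def F_def[abs_def])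
  have per: "F (z + l) = F z" if "l \<in> \<Lambda>" for z l
    using inv that by (simp add: invariant_under_p3_group F_def)
  have rot: "F (\<omega> * z) = F z" for z
    using inv by (simp add: invariant_under_p3_group F_def)
  obtain q where q: "q \<noteq> 0" "\<And>z. z \<notin> \<Lambda> \<Longrightarrow> \<not> is_pole (\<lambda>w. poly q (wp_deriv w) * F w) z"
    using clear_poles[OF mero per] by blast
  define g where "g z = poly q (wp_deriv z) * F z" for z
  have g: "g meromorphic_on UNIV"
    unfolding g_def[abs_def] by (intro meromorphic_intros mero wp_deriv_meromorphic)
  obtain N c where "(\<lambda>z. (z - 0) ^ N * g z) \<midarrow>0\<rightarrow> c"
    using meromorphic_imp_tendsto_power_mult[OF meromorphic_on_subset[OF g]] by blast
  \<comment> \<open>The extra factor raises the exponent from N to 3 N, a multiple of 3 as the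
    induction on the pole order requires.\<close>
  hence "(\<lambda>z. z ^ (2 * N) * ((z - 0) ^ N * g z)) \<midarrow>0\<rightarrow> 0 ^ (2 * N) * c"
    by (intro tendsto_intros)
  also have "(\<lambda>z. z ^ (2 * N) * ((z - 0) ^ N * g z)) = (\<lambda>z. z ^ (3 * N) * g z)"
    by (simp add: mult.assoc[symmetric] power_add[symmetric])
  finally have "\<exists>p. \<forall>z. eventually (\<lambda>w. g w = poly p (wp_deriv w)) (at z)"
    by (intro poles_in_lattice_imp_poly g) (use q(2) in \<open>auto simp: g_def[abs_def] per rot wp_deriv_add wp_deriv_rotate\<close>)
  then obtain p where p: "\<And>z. eventually (\<lambda>w. g w = poly p (wp_deriv w)) (at z)"
    by blast
  define R where "R = Fract p q"
  obtain p' q' where R: "quot_of_fract R = (p', q')"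
    by (cases "quot_of_fract R") auto
  have q': "q' \<noteq> 0"
    using snd_quot_of_fract_nonzero[of R] by (simp add: R)
  \<comment> \<open>\<open>rat_eval\<close> works with the reduced pair p', q', whereas the
    construction gave p, q; cross multiplication relates the two.\<close>
  have "Fract p' q' = Fract p q"
    by (metis Fract_quot_of_fract R R_def fst_conv snd_conv)
  hence cross: "p' * q = p * q'"
    using q(1) q' by (simp add: eq_fract)
  have "f = (\<lambda>z. rat_eval R (cp1_deriv (weierstrass_p \<Lambda>) z))"
  proof (rule cp1_meromorphic_eqI[OF f rat_eval_wp_deriv_cp1_meromorphic])
    fix z
    show "eventually (\<lambda>w. fin_part (f w) = fin_part (rat_eval R (cp1_deriv (weierstrass_p \<Lambda>) w))) (at z)"
      using p[of z] poly_wp_deriv_eventually_nonzero[OF q(1), of z]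
        poly_wp_deriv_eventually_nonzero[OF q', of z] eventually_fin_part_rat_eval[OF R, of z]
    proof eventually_elim
      case (elim w)
      have "poly p' (wp_deriv w) * poly q (wp_deriv w) = poly p (wp_deriv w) * poly q' (wp_deriv w)"
        using cross by (metis poly_mult)
      also have "poly p (wp_deriv w) = poly q (wp_deriv w) * F w"
        using elim(1) by (simp add: g_def)
      finally have "F w = poly p' (wp_deriv w) / poly q' (wp_deriv w)"
        using elim(2,3) by (simp add: field_simps)
      thus ?case
        using elim(4) by (simp add: F_def)
    qed
  qed
  thus "\<exists>R. f = (\<lambda>z. rat_eval R (cp1_deriv (weierstrass_p \<Lambda>) z))"
    by blast
qed

end

theorem corollary8:
  fixes \<omega> \<omega>\<^sub>1 :: complex and \<Lambda> :: "complex set"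
    and G :: "(complex \<Rightarrow> complex) set" and f :: "complex \<Rightarrow> cp1"
  assumes "\<omega> ^ 3 = 1" and "\<omega> \<noteq> 1" and "\<omega>\<^sub>1 \<noteq> 0"
    and "\<Lambda> = int_lattice \<omega>\<^sub>1 (\<omega> * \<omega>\<^sub>1)"
    and "G = p3_group \<omega> \<Lambda>"
  shows "cp1_meromorphic f \<and> invariant_under G f \<longleftrightarrow>
         (\<exists>R :: complex poly fract. f = (\<lambda>z. rat_eval R (cp1_deriv (weierstrass_p \<Lambda>) z)))"
proof -
  interpret hexagonal_lattice \<omega> \<omega>\<^sub>1 \<Lambda>
    by unfold_locales (use assms in auto)
  show ?thesis
    unfolding assms(5) by (rule p3_invariant_iff_rational)
qed

end
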